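(* Consider the randomly switched system $\dot x = f_\sigma(x)$, $(x(0),\sigma(0))=(x_0,\sigma_0)$, $t\ge 0$. Suppose that: (G1) there exist continuously differentiable functions $V_i:\mathbb{R}^n\to\mathbb{R}$, $i\in\mathcal P$, functions $\alpha_1,\alpha_2\in\mathcal K_\infty$, and numbers $\mu>1$ and $\lambda_{i,j}\in\mathbb{R}$, $i,j\in\mathcal P$, such that for all $x\in\mathbb{R}^n$ and $i,j\in\mathcal P$: $\alpha_1(\|x\|)\le V_i(x)\le\alpha_2(\|x\|)$; $\langle\nabla V_i(x), f_j(x)\rangle\le -\lambda_{i,j} V_i(x)$; $V_i(x)\le\mu V_j(x)$; (G2) the switching signal $\sigma$ belongs to class GH, with transition probability matrix $P=[p_{i,j}]_{i,j\in\mathcal P}$ and holding times $(S_k)_{k\in\mathbb{N}}$; (G3) there exists $\theta\in[0,1[$ such that $$\max_{i\in\mathcal P}\sum_{j\in\mathcal P}\mu\, p_{i,j}\,\mathsf E\!\left[e^{-\lambda_{j,i}S_k}\right]\le\theta .$$ Then the system is globally asymptotically stable almost surely.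
   Context: Notation: $\mathbb{N}=\{1,2,\dots\}$, $\mathbb{N}_0=\mathbb{N}\cup\{0\}$, $\|\cdot\|$ is the Euclidean norm, $\mathsf E$ is expectation (of nonnegative random variables, with values in $[0,\infty]$). A function $\alpha:[0,\infty[\to[0,\infty[$ is of class $\mathcal K$ if it is continuous, strictly increasing and $\alpha(0)=0$; it is of class $\mathcal K_\infty$ if in addition it is unbounded. Setting: $\mathcal P=\{1,\dots,\mathrm N\}$ is a finite index set; for each $i\in\mathcal P$ the vector field $f_i:\mathbb{R}^n\to\mathbb{R}^n$ is locally Lipschitz with $f_i(0)=0$. On a complete probability space $(\Omega,\mathfrak F,\mathsf P)$, the switching signal $\sigma=(\sigma(t))_{t\ge0}$ is a càdlàg $\mathcal P$-valued process with $\sigma(0)=\sigma_0$ deterministic. Its switching instants are $0=\tau_0<\tau_1<\tau_2<\cdots$ (almost surely); $\sigma$ is constant on each $[\tau_i,\tau_{i+1}[$, and $\sigma(\tau_i)=\sigma(\tau_{i-1})$ is allowed. The holding times are $S_i:=\tau_i-\tau_{i-1}$, $i\in\mathbb{N}$. The state $x$ does not jump at switching instants, and $x(\cdot)$ denotes the (pathwise, Carathéodory, absolutely continuous) solution of the switched system for the initial state $x_0$; it depends on $x_0$ and $\omega\in\Omega$. Class GH: $\sigma$ belongs to class GH if (GH1) $(S_i)_{i\in\mathbb{N}}$ is i.i.d. with $\mathsf E[S_i]<\infty$; (GH2) $(\sigma(\tau_i))_{i\in\mathbb{N}_0}$ is a discrete-time (time-homogeneous) Markov chain with initial distribution the Dirac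 measure at $\sigma_0$ and transition probability matrix $P=[p_{i,j}]_{i,j\in\mathcal P}$; (GH3) $(S_i)_{i\in\mathbb{N}}$ is independent of $(\sigma(\tau_i))_{i\in\mathbb{N}_0}$. Since the $S_k$ are identically distributed, $\mathsf E[e^{-\lambda_{j,i}S_k}]$ does not depend on $k$. Global asymptotic stability almost surely means: (AS1) with probability one, for every $\varepsilon>0$ there is $\delta>0$ such that for every $x_0$, $\|x_0\|<\delta$ implies $\sup_{t\ge0}\|x(t)\|<\varepsilon$; and (AS2) with probability one, for all $r,\varepsilon'>0$ there is $T\ge0$ such that for every $x_0$, $\|x_0\|<r$ implies $\sup_{t\ge T}\|x(t)\|<\varepsilon'$. ($\delta$ and $T$ may depend on $\omega$.) *)

theory Defs
  imports "HOL-Probability.Probability"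
begin

section \<open>Comparison functions and gradients\<close>

text \<open>Comparison functions live on the half-line $[0,\infty[$; the values of the total function
  outside of it are irrelevant.\<close>

definition class_K :: "(real \<Rightarrow> real) \<Rightarrow> bool" where
  "class_K \<alpha> \<longleftrightarrow> continuous_on {0..} \<alpha> \<and> strict_mono_on {0..} \<alpha> \<and> \<alpha> 0 = 0"

definition class_K_inf :: "(real \<Rightarrow> real) \<Rightarrow> bool" where
  "class_K_inf \<alpha> \<longleftrightarrow> class_K \<alpha> \<and> \<not> bdd_above (\<alpha> ` {0..})"

definition gradient :: "('a::real_inner \<Rightarrow> real) \<Rightarrow> 'a \<Rightarrow> 'a" where
  "gradient V x = (THE D. GDERIV V x :> D)"

definition continuously_differentiable :: "('a::real_inner \<Rightarrow> real) \<Rightarrow> bool" where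
  "continuously_differentiable V \<longleftrightarrow>
     (\<forall>x. \<exists>D. GDERIV V x :> D) \<and> continuous_on UNIV (gradient V)"

section \<open>Caratheodory solutions\<close>

text \<open>The finite set \<open>D\<close> of pairs encodes a finite family of non-overlapping subintervals
  of $[a,b]$.\<close>

definition abs_continuous_on_interval :: "real \<Rightarrow> real \<Rightarrow> (real \<Rightarrow> 'a::real_normed_vector) \<Rightarrow> bool" where
  "abs_continuous_on_interval a b g \<longleftrightarrow>
     (\<forall>\<epsilon>>0. \<exists>\<delta>>0. \<forall>D::(real \<times> real) set.
        finite D \<and> (\<forall>(u, v)\<in>D. a \<le> u \<and> u \<le> v \<and> v \<le> b) \<and>
        disjoint_family_on (\<lambda>(u, v). {u<..<v}) D \<and> (\<Sum>(u, v)\<in>D. v - u) < \<delta> \<longrightarrow>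
        (\<Sum>(u, v)\<in>D. norm (g v - g u)) < \<epsilon>)"

text \<open>Solutions of $\dot\xi(t) = f_{s(t)}(\xi(t))$, $\xi(0) = x_0$, on $[0,\infty[$ along a fixed
  path \<open>s\<close> of the switching signal.\<close>

definition caratheodory_solution ::
    "('p \<Rightarrow> 'a::real_normed_vector \<Rightarrow> 'a) \<Rightarrow> (real \<Rightarrow> 'p) \<Rightarrow> 'a \<Rightarrow> (real \<Rightarrow> 'a) \<Rightarrow> bool" where
  "caratheodory_solution f s x\<^sub>0 \<xi> \<longleftrightarrow>
     \<xi> 0 = x\<^sub>0 \<and> (\<forall>T\<ge>0. abs_continuous_on_interval 0 T \<xi>) \<and>
     (AE t in lebesgue. 0 \<le> t \<longrightarrow> (\<xi> has_vector_derivative f (s t) (\<xi> t)) (at t within {0..}))"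

section \<open>Switching signals\<close>

text \<open>The mode set is discrete, so that one-sided limits along a path mean that the path is
  eventually constant on that side.\<close>

definition cadlag_path :: "(real \<Rightarrow> 'p) \<Rightarrow> bool" where
  "cadlag_path s \<longleftrightarrow>
     (\<forall>t\<ge>0. eventually (\<lambda>u. s u = s t) (at_right t)) \<and>
     (\<forall>t>0. \<exists>l. eventually (\<lambda>u. s u = l) (at_left t))"

text \<open>\<open>\<tau>\<close> is part of the data: since the mode may stay the same at a switching instant, the
  instants are not determined by the paths of \<open>\<sigma>\<close>.  Path properties are required almost surely.\<close>

definition switching_signal ::
    "'w measure \<Rightarrow> (real \<Rightarrow> 'w \<Rightarrow> 'p) \<Rightarrow> 'p \<Rightarrow> (nat \<Rightarrow> 'w \<Rightarrow> real) \<Rightarrow> bool" where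
  "switching_signal M \<sigma> \<sigma>\<^sub>0 \<tau> \<longleftrightarrow>
     (\<forall>t\<ge>0. \<sigma> t \<in> measurable M (count_space UNIV)) \<and>
     (\<forall>i. \<tau> i \<in> borel_measurable M) \<and>
     (AE \<omega> in M. cadlag_path (\<lambda>t. \<sigma> t \<omega>) \<and> \<sigma> 0 \<omega> = \<sigma>\<^sub>0 \<and>
        \<tau> 0 \<omega> = 0 \<and> strict_mono (\<lambda>i. \<tau> i \<omega>) \<and>
        (\<forall>i. \<forall>t\<in>{\<tau> i \<omega>..<\<tau> (Suc i) \<omega>}. \<sigma> t \<omega> = \<sigma> (\<tau> i \<omega>) \<omega>))"

text \<open>Meaningful for \<open>i \<ge> 1\<close> only; holding times are indexed by \<open>{1..}\<close> throughout.\<close>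

definition holding_time :: "(nat \<Rightarrow> 'w \<Rightarrow> real) \<Rightarrow> nat \<Rightarrow> 'w \<Rightarrow> real" where
  "holding_time \<tau> i \<omega> = \<tau> i \<omega> - \<tau> (i - 1) \<omega>"

definition jump_chain :: "(real \<Rightarrow> 'w \<Rightarrow> 'p) \<Rightarrow> (nat \<Rightarrow> 'w \<Rightarrow> real) \<Rightarrow> nat \<Rightarrow> 'w \<Rightarrow> 'p" where
  "jump_chain \<sigma> \<tau> i \<omega> = \<sigma> (\<tau> i \<omega>) \<omega>"

definition stochastic_matrix :: "('p::finite \<Rightarrow> 'p \<Rightarrow> real) \<Rightarrow> bool" where
  "stochastic_matrix p \<longleftrightarrow> (\<forall>i j. 0 \<le> p i j) \<and> (\<forall>i. (\<Sum>j\<in>UNIV. p i j) = 1)"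

definition markov_chain ::
    "'w measure \<Rightarrow> (nat \<Rightarrow> 'w \<Rightarrow> 'p::finite) \<Rightarrow> 'p \<Rightarrow> ('p \<Rightarrow> 'p \<Rightarrow> real) \<Rightarrow> bool" where
  "markov_chain M X \<iota> p \<longleftrightarrow>
     stochastic_matrix p \<and>
     (\<forall>k. X k \<in> measurable M (count_space UNIV)) \<and>
     \<P>(\<omega> in M. X 0 \<omega> = \<iota>) = 1 \<and>
     (\<forall>k s j. \<P>(\<omega> in M. \<forall>m\<le>k. X m \<omega> = s m) > 0 \<longrightarrow>
        \<P>(\<omega> in M. X (Suc k) \<omega> = j \<bar> \<forall>m\<le>k. X m \<omega> = s m) = p (s k) j)"

text \<open>The last condition states independence of the \<open>\<sigma>\<close>-algebras generated by the two sequences.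
  The constant \<open>prob_space.indep_var\<close> does not apply, as it requires both variables to have
  the same value type.\<close>

definition class_GH ::
    "'w measure \<Rightarrow> (real \<Rightarrow> 'w \<Rightarrow> 'p::finite) \<Rightarrow> 'p \<Rightarrow> (nat \<Rightarrow> 'w \<Rightarrow> real) \<Rightarrow>
     ('p \<Rightarrow> 'p \<Rightarrow> real) \<Rightarrow> bool" where
  "class_GH M \<sigma> \<sigma>\<^sub>0 \<tau> p \<longleftrightarrow>
     prob_space.indep_vars M (\<lambda>_. borel) (holding_time \<tau>) {1..} \<and>
     (\<forall>i\<ge>1. \<forall>j\<ge>1. distr M borel (holding_time \<tau> i) = distr M borel (holding_time \<tau> j)) \<and>
     (\<forall>i\<ge>1. (\<integral>\<^sup>+\<omega>. ennreal (holding_time \<tau> i \<omega>) \<partial>M) < \<infinity>) \<and>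
     markov_chain M (jump_chain \<sigma> \<tau>) \<sigma>\<^sub>0 p \<and>
     prob_space.indep_set M
       (sets (vimage_algebra (space M) (\<lambda>\<omega>. \<lambda>i\<in>{1..}. holding_time \<tau> i \<omega>)
          (\<Pi>\<^sub>M i\<in>{1..}. borel)))
       (sets (vimage_algebra (space M) (\<lambda>\<omega> i. jump_chain \<sigma> \<tau> i \<omega>)
          (\<Pi>\<^sub>M i\<in>UNIV. count_space UNIV)))"

section \<open>Stability\<close>

text \<open>\<open>x x\<^sub>0 \<omega> t\<close> is the state at time \<open>t\<close>.  Suprema are taken in the extended reals because real
  suprema of unbounded sets are unspecified.\<close>

definition gas_almost_surely ::
    "'w measure \<Rightarrow> ('a::real_normed_vector \<Rightarrow> 'w \<Rightarrow> real \<Rightarrow> 'a) \<Rightarrow> bool" where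
  "gas_almost_surely M x \<longleftrightarrow>
     (AE \<omega> in M. \<forall>\<epsilon>>0. \<exists>\<delta>>0. \<forall>x\<^sub>0. norm x\<^sub>0 < \<delta> \<longrightarrow>
        (SUP t\<in>{0..}. ereal (norm (x x\<^sub>0 \<omega> t))) < ereal \<epsilon>) \<and>
     (AE \<omega> in M. \<forall>r>0. \<forall>\<epsilon>>0. \<exists>T\<ge>0. \<forall>x\<^sub>0. norm x\<^sub>0 < r \<longrightarrow>
        (SUP t\<in>{T..}. ereal (norm (x x\<^sub>0 \<omega> t))) < ereal \<epsilon>)"

end

theory Submission
  imports Defs
begin

text \<open>
  Let \<open>w k\<close> be the product over \<open>m = 1, \<dots>, k\<close> of the factors \<open>\<mu> * exp (- lam (X m) (X (m - 1)) * S m)\<close>,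
  where \<open>X m\<close> is the mode at the \<open>m\<close>-th switching instant. During the \<open>m\<close>-th holding time the mode
  is \<open>X (m - 1)\<close>; applying the decay condition to the Lyapunov function of the \<^emph>\<open>following\<close> mode
  \<open>X m\<close> bounds the Lyapunov value at the \<open>k\<close>-th instant by \<open>w k\<close> times its initial value, on every
  path and for all initial states at once. Summing over the finitely many mode sequences, the Markov
  property and independence give \<open>E (w (k + 1)) \<le> \<theta> * E (w k)\<close>. Hence the \<open>w k\<close> are almost surely
  summable and tend to 0, and both stability properties follow path by path.
\<close>

section \<open>Absolutely continuous functions and Caratheodory solutions\<close>

lemma abs_continuous_on_interval_subset:
  assumes "abs_continuous_on_interval a b g" "a \<le> c" "d \<le> b"
  shows "abs_continuous_on_interval c d g"
  unfolding abs_continuous_on_interval_def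
proof (intro allI impI)
  fix \<epsilon> :: real assume "\<epsilon> > 0"
  then obtain \<delta> where "\<delta> > 0" and \<delta>: "\<And>D. finite D \<and> (\<forall>(u, v)\<in>D. a \<le> u \<and> u \<le> v \<and> v \<le> b) \<and>
        disjoint_family_on (\<lambda>(u, v). {u<..<v}) D \<and> (\<Sum>(u, v)\<in>D. v - u) < \<delta> \<Longrightarrow>
        (\<Sum>(u, v)\<in>D. norm (g v - g u)) < \<epsilon>"
    using assms(1) unfolding abs_continuous_on_interval_def by meson
  show "\<exists>\<delta>>0. \<forall>D. finite D \<and> (\<forall>(u, v)\<in>D. c \<le> u \<and> u \<le> v \<and> v \<le> d) \<and>
        disjoint_family_on (\<lambda>(u, v). {u<..<v}) D \<and> (\<Sum>(u, v)\<in>D. v - u) < \<delta> \<longrightarrow>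
        (\<Sum>(u, v)\<in>D. norm (g v - g u)) < \<epsilon>"
  proof (intro exI[of _ \<delta>] conjI allI impI, goal_cases)
    case (2 D)
    then show ?case using assms(2,3) by (intro \<delta>) fastforce
  qed (fact \<open>\<delta> > 0\<close>)
qed

lemma abs_continuous_on_interval_imp_continuous_on:
  assumes "abs_continuous_on_interval a b g"
  shows "continuous_on {a..b} g"
  unfolding continuous_on_iff
proof (intro ballI allI impI)
  fix t \<epsilon> :: real assume t: "t \<in> {a..b}" and "\<epsilon> > 0"
  then obtain \<delta> where "\<delta> > 0" and \<delta>: "\<And>D. finite D \<and> (\<forall>(u, v)\<in>D. a \<le> u \<and> u \<le> v \<and> v \<le> b) \<and>
        disjoint_family_on (\<lambda>(u, v). {u<..<v}) D \<and> (\<Sum>(u, v)\<in>D. v - u) < \<delta> \<Longrightarrow>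
        (\<Sum>(u, v)\<in>D. norm (g v - g u)) < \<epsilon>"
    using assms(1) unfolding abs_continuous_on_interval_def by meson
  have "dist (g s) (g t) < \<epsilon>" if "s \<in> {a..b}" "dist s t < \<delta>" for s
  proof (cases "s \<le> t")
    case True
    then show ?thesis
      using \<delta>[of "{(s, t)}"] that t by (auto simp: dist_norm disjoint_family_on_def norm_minus_commute)
  next
    case False
    then show ?thesis
      using \<delta>[of "{(t, s)}"] that t by (auto simp: dist_norm disjoint_family_on_def)
  qed
  with \<open>\<delta> > 0\<close> show "\<exists>d>0. \<forall>s\<in>{a..b}. dist s t < d \<longrightarrow> dist (g s) (g t) < \<epsilon>" by blast
qed

text \<open>Links two notions of smallness: the measure of an open cover of a null set, and the
  total length that absolute continuity asks for.\<close>

lemma sum_lengths_le_measure: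
  fixes D :: "(real \<times> real) set"
  assumes "finite D" "\<And>u v. (u, v) \<in> D \<Longrightarrow> u \<le> v"
    and disj: "disjoint_family_on (\<lambda>(u, v). {u<..<v}) D"
    and sub: "\<And>u v. (u, v) \<in> D \<Longrightarrow> {u<..<v} \<subseteq> U" and "open U"
  shows "ennreal (\<Sum>(u, v)\<in>D. v - u) \<le> emeasure lebesgue U"
proof -
  have U: "U \<in> sets lborel" using \<open>open U\<close> by simp
  have "ennreal (\<Sum>(u, v)\<in>D. v - u) = (\<Sum>q\<in>D. ennreal (snd q - fst q))"
    using assms(1,2) by (subst sum_ennreal) (auto simp: case_prod_beta)
  also have "\<dots> = (\<Sum>q\<in>D. emeasure lborel ((\<lambda>(u, v). {u<..<v}) q))"
    using assms(2) by (intro sum.cong) auto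
  also have "\<dots> = emeasure lborel (\<Union>q\<in>D. (\<lambda>(u, v). {u<..<v}) q)"
    using assms by (intro sum_emeasure) auto
  also have "\<dots> \<le> emeasure lborel U"
    using sub U by (intro emeasure_mono) auto
  also have "\<dots> = emeasure lebesgue U"
    using U by simp
  finally show ?thesis .
qed

text \<open>A Henstock-Kurzweil argument on tagged divisions. At tags outside \<open>N\<close>
  differentiability controls the error; at tags in \<open>N\<close> the gauge confines the intervals
  to an open set of small measure, where absolute continuity makes the total increment of
  \<open>g\<close> small.\<close>

theorem fundamental_theorem_of_calculus_abs_continuous:
  fixes g :: "real \<Rightarrow> 'a::banach"
  assumes "a \<le> b" and ac: "abs_continuous_on_interval a b g"
    and N: "negligible N"
    and deriv: "\<And>t. t \<in> {a..b} - N \<Longrightarrow> (g has_vector_derivative g' t) (at t within {a..b})"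
  shows "(g' has_integral (g b - g a)) {a..b}"
proof (cases "a = b")
  case False
  with \<open>a \<le> b\<close> have "a < b" by simp
  \<comment> \<open>With value 0 on \<open>N\<close>, a tag in \<open>N\<close> contributes only the
    increment of \<open>g\<close>; the change is invisible to the integral because \<open>N\<close>
    is negligible.\<close>
  define G where "G t = (if t \<in> N then 0 else g' t)" for t
  have "(G has_integral (g b - g a)) {a..b}"
    unfolding has_integral_factor_content box_real[symmetric]
  proof safe
    fix e :: real assume "e > 0"
    \<comment> \<open>One half of the error for the tags outside \<open>N\<close>, the other half
      for those in \<open>N\<close>.\<close>
    define e' where "e' = e / 2"
    have "e' > 0" "e' * (b - a) > 0" using \<open>e > 0\<close> \<open>a < b\<close> by (auto simp: e'_def)
    then obtain \<delta> where "\<delta> > 0" and \<delta>: "\<And>D. finite D \<and> (\<forall>(u, v)\<in>D. a \<le> u \<and> u \<le> v \<and> v \<le> b) \<and>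
        disjoint_family_on (\<lambda>(u, v). {u<..<v}) D \<and> (\<Sum>(u, v)\<in>D. v - u) < \<delta> \<Longrightarrow>
        (\<Sum>(u, v)\<in>D. norm (g v - g u)) < e' * (b - a)"
      using ac unfolding abs_continuous_on_interval_def by meson
    have Nnull: "N \<in> null_sets lebesgue" using N by (simp add: negligible_iff_null_sets)
    then have Nsets: "N \<in> sets lebesgue" by blast
    \<comment> \<open>Outer regularity covers the null set by an open set of measure below the
      \<delta> of absolute continuity.\<close>
    obtain U where U: "open U" "N \<subseteq> U" "U - N \<in> lmeasurable" "emeasure lebesgue (U - N) < ennreal \<delta>"
      using sets_lebesgue_outer_open[OF Nsets \<open>\<delta> > 0\<close>] .
    have "emeasure lebesgue U = emeasure lebesgue (U - N)"
      using Nnull U(1) by (simp add: emeasure_Diff_null_set borel_open)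
    with U(4) have Ud: "emeasure lebesgue U < ennreal \<delta>" by simp
    have "\<forall>t. \<exists>d>0. (t \<in> {a..b} - N \<longrightarrow>
        (\<forall>y\<in>{a..b}. norm (y-t) < d \<longrightarrow> norm (g y - g t - (y-t) *\<^sub>R g' t) \<le> e' * norm (y-t))) \<and>
        (t \<in> N \<longrightarrow> ball t d \<subseteq> U)"
    proof
      fix t
      show "\<exists>d>0. (t \<in> {a..b} - N \<longrightarrow>
        (\<forall>y\<in>{a..b}. norm (y-t) < d \<longrightarrow> norm (g y - g t - (y-t) *\<^sub>R g' t) \<le> e' * norm (y-t))) \<and>
        (t \<in> N \<longrightarrow> ball t d \<subseteq> U)"
      proof (cases "t \<in> N")
        case True
        then show ?thesis using U(1,2) by (metis DiffD2 open_contains_ball subsetD)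
      next
        case False
        then show ?thesis
          using deriv[of t, unfolded has_vector_derivative_def has_derivative_within_alt] \<open>e' > 0\<close>
          by (cases "t \<in> {a..b}") (auto intro: exI[of _ 1])
      qed
    qed
    then obtain d where d0: "\<And>t. 0 < d t"
      and d: "\<And>t y. \<lbrakk>t \<in> {a..b} - N; y \<in> {a..b}; norm (y-t) < d t\<rbrakk>
                \<Longrightarrow> norm (g y - g t - (y-t) *\<^sub>R g' t) \<le> e' * norm (y-t)"
      and dN: "\<And>t. t \<in> N \<Longrightarrow> ball t (d t) \<subseteq> U"
      by metis
    show "\<exists>d. gauge d \<and> (\<forall>p. p tagged_division_of (cbox a b) \<and> d fine p \<longrightarrow>
      norm ((\<Sum>(x, k)\<in>p. measure lborel k *\<^sub>R G x) - (g b - g a)) \<le> e * measure lborel (cbox a b))"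
    proof (rule exI, safe)
      show "gauge (\<lambda>x. ball x (d x))" using d0 gauge_ball_dependent by blast
    next
      fix p
      assume ptag: "p tagged_division_of cbox a b" and finep: "(\<lambda>x. ball x (d x)) fine p"
      have finp: "finite p" using ptag by blast
      have ba: "b - a = (\<Sum>(x,K)\<in>p. Sup K - Inf K)" "g b - g a = (\<Sum>(x,K)\<in>p. g(Sup K) - g(Inf K))"
        using additive_tagged_division_1[where f= "\<lambda>x. x"] additive_tagged_division_1[where f= g]
              \<open>a \<le> b\<close> ptag by auto
      have K: "\<exists>u v. K = {u..v} \<and> u \<le> v \<and> Inf K = u \<and> Sup K = v \<and> a \<le> u \<and> v \<le> b \<and> u \<le> x \<and> x \<le> v \<and>
          {u..v} \<subseteq> ball x (d x)" if xK: "(x, K) \<in> p" for x K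
      proof -
        have "x \<in> K" "K \<subseteq> cbox a b" using ptag xK by blast+
        moreover obtain u v where uv: "K = cbox u v" using tagged_division_ofD(4)[OF ptag xK] by blast
        moreover have "K \<subseteq> ball x (d x)" using finep xK by blast
        ultimately show ?thesis by (intro exI[of _ u] exI[of _ v]) auto
      qed
      define p1 where "p1 = {q \<in> p. fst q \<notin> N}"
      define p2 where "p2 = {q \<in> p. fst q \<in> N}"
      have p: "p = p1 \<union> p2" "p1 \<inter> p2 = {}" "finite p1" "finite p2"
        using finp by (auto simp: p1_def p2_def)
      have len0: "0 \<le> (case q of (x, K) \<Rightarrow> Sup K - Inf K)" if "q \<in> p" for q
        using K that by (cases q) fastforce
      define T where "T = (\<lambda>(x, K). measure lborel K *\<^sub>R G x - (g (Sup K) - g (Inf K)))"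
      have "norm (\<Sum>q\<in>p1. T q) \<le> (\<Sum>q\<in>p1. e' * (case q of (x, K) \<Rightarrow> Sup K - Inf K))"
      proof (rule sum_norm_le)
        fix q assume q: "q \<in> p1"
        obtain x K where qK: "q = (x, K)" by (cases q)
        with q have xK: "(x, K) \<in> p" and xN: "x \<notin> N" by (auto simp: p1_def)
        obtain u v where uv: "K = {u..v}" "u \<le> v" "Inf K = u" "Sup K = v" "a \<le> u" "v \<le> b" "u \<le> x" "x \<le> v"
          "{u..v} \<subseteq> ball x (d x)" using K[OF xK] by blast
        have "u \<in> {u..v}" "v \<in> {u..v}" using uv(2) by simp_all
        then have "u \<in> ball x (d x)" "v \<in> ball x (d x)" using uv(9) by blast+
        then have dd: "norm (u - x) < d x" "norm (v - x) < d x" by (auto simp: dist_norm norm_minus_commute)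
        \<comment> \<open>The increment is split at the tag. As \<open>u \<le> x \<le> v\<close>,
          the two error bounds add up to a multiple of \<open>v - u\<close>.\<close>
        have "T q = (g u - g x - (u - x) *\<^sub>R g' x) - (g v - g x - (v - x) *\<^sub>R g' x)"
          using uv xN by (simp add: T_def qK G_def algebra_simps)
        also have "norm \<dots> \<le> norm (g u - g x - (u - x) *\<^sub>R g' x) + norm (g v - g x - (v - x) *\<^sub>R g' x)"
          by (rule norm_triangle_ineq4)
        also have "\<dots> \<le> e' * norm (u - x) + e' * norm (v - x)"
          using uv xN dd by (intro add_mono d) auto
        also have "\<dots> = e' * (v - u)" using uv by (simp add: algebra_simps)
        finally show "norm (T q) \<le> e' * (case q of (x, K) \<Rightarrow> Sup K - Inf K)"
          by (simp add: qK uv)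
      qed
      also have "\<dots> \<le> (\<Sum>q\<in>p. e' * (case q of (x, K) \<Rightarrow> Sup K - Inf K))"
        using \<open>e' > 0\<close> len0 by (intro sum_mono2 finp mult_nonneg_nonneg) (auto simp: p1_def)
      also have "\<dots> = e' * (b - a)" by (simp add: sum_distrib_left[symmetric] ba(1))
      finally have b1: "norm (\<Sum>q\<in>p1. T q) \<le> e' * (b - a)" .
      \<comment> \<open>Forgetting the tags turns tagged intervals into the endpoint pairs that
        absolute continuity is stated with.\<close>
      define h where "h = (\<lambda>(x::real, K::real set). (Inf K, Sup K))"
      have disjp: "interior K1 \<inter> interior K2 = {}"
        if "(x1, K1) \<in> p" "(x2, K2) \<in> p" "(x1, K1) \<noteq> (x2, K2)" for x1 x2 K1 K2
        using ptag that by blast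
      \<comment> \<open>Distinct tagged intervals have disjoint interiors. With equal endpoints each
        would be a single point, which is then also the tag of both.\<close>
      have inj: "inj_on h p2"
      proof (rule inj_onI, rule ccontr)
        fix q1 q2 assume q: "q1 \<in> p2" "q2 \<in> p2" "h q1 = h q2" "q1 \<noteq> q2"
        obtain x1 K1 x2 K2 where qq: "q1 = (x1, K1)" "q2 = (x2, K2)" by (metis surj_pair)
        have i: "(x1, K1) \<in> p" "(x2, K2) \<in> p" using q qq by (auto simp: p2_def)
        from K[OF i(1)] K[OF i(2)] q(3) obtain u v where uv: "K1 = {u..v}" "K2 = {u..v}" "u \<le> v"
          "u \<le> x1" "x1 \<le> v" "u \<le> x2" "x2 \<le> v"
          unfolding h_def qq by auto
        have "interior K1 \<inter> interior K2 = {}" using disjp[OF i] q(4) qq by simp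
        then have "u = v" using uv by auto
        then show False using uv q(4) qq by auto
      qed
      have hD: "a \<le> u \<and> u \<le> v \<and> v \<le> b \<and> {u<..<v} \<subseteq> U" if "(u, v) \<in> h ` p2" for u v
      proof -
        from that obtain x K where xK: "(x, K) \<in> p" "x \<in> N" "u = Inf K" "v = Sup K"
          by (auto simp: p2_def h_def)
        obtain u' v' where uv: "K = {u'..v'}" "u' \<le> v'" "Inf K = u'" "Sup K = v'" "a \<le> u'" "v' \<le> b"
          "{u'..v'} \<subseteq> ball x (d x)" using K[OF xK(1)] by blast
        have "{u<..<v} \<subseteq> {u'..v'}" using uv(3,4) xK(3,4) by auto
        then have "{u<..<v} \<subseteq> U" using uv(7) dN[OF xK(2)] by blast
        then show ?thesis using uv(2-6) xK(3,4) by simp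
      qed
      have disj: "disjoint_family_on (\<lambda>(u, v). {u<..<v}) (h ` p2)"
        unfolding disjoint_family_on_def
      proof (intro ballI impI)
        fix q1 q2 assume "q1 \<in> h ` p2" "q2 \<in> h ` p2" and ne: "q1 \<noteq> q2"
        then obtain x1 K1 x2 K2 where q: "(x1, K1) \<in> p" "(x2, K2) \<in> p" "q1 = h (x1, K1)" "q2 = h (x2, K2)"
          by (auto simp: p2_def)
        then have "interior K1 \<inter> interior K2 = {}" using ne by (intro disjp[of x1 _ x2]) auto
        then show "(case q1 of (u, v) \<Rightarrow> {u<..<v}) \<inter> (case q2 of (u, v) \<Rightarrow> {u<..<v}) = {}"
          using K[OF q(1)] K[OF q(2)] unfolding q(3,4) h_def case_prod_conv by fastforce
      qed
      have "ennreal (\<Sum>(u, v)\<in>h ` p2. v - u) \<le> emeasure lebesgue U"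
        using hD disj p(4) U(1) by (intro sum_lengths_le_measure) blast+
      then have "ennreal (\<Sum>(u, v)\<in>h ` p2. v - u) < ennreal \<delta>"
        using Ud by (rule le_less_trans)
      then have "(\<Sum>(u, v)\<in>h ` p2. v - u) < \<delta>"
        by (metis ennreal_leI not_less)
      then have "(\<Sum>(u, v)\<in>h ` p2. norm (g v - g u)) < e' * (b - a)"
        using hD disj p(4) by (intro \<delta> conjI finite_imageI) blast+
      moreover have "norm (\<Sum>q\<in>p2. T q) \<le> (\<Sum>(u, v)\<in>h ` p2. norm (g v - g u))"
        unfolding sum.reindex[OF inj]
        by (rule sum_norm_le) (auto simp: p2_def T_def h_def G_def norm_minus_commute)
      ultimately have b2: "norm (\<Sum>q\<in>p2. T q) \<le> e' * (b - a)" by simp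
      have "(\<Sum>(x, k)\<in>p. measure lborel k *\<^sub>R G x) - (g b - g a) = (\<Sum>q\<in>p. T q)"
        unfolding ba(2) T_def sum_subtractf[symmetric] by (simp add: case_prod_beta)
      also have "\<dots> = (\<Sum>q\<in>p1. T q) + (\<Sum>q\<in>p2. T q)"
        unfolding p(1) using p(2-4) by (intro sum.union_disjoint)
      finally have "norm ((\<Sum>(x, k)\<in>p. measure lborel k *\<^sub>R G x) - (g b - g a))
          \<le> norm (\<Sum>q\<in>p1. T q) + norm (\<Sum>q\<in>p2. T q)"
        using norm_triangle_ineq by metis
      also have "\<dots> \<le> e * measure lborel (cbox a b)"
        using b1 b2 \<open>a \<le> b\<close> by (simp add: e'_def)
      finally show "norm ((\<Sum>(x, k)\<in>p. measure lborel k *\<^sub>R G x) - (g b - g a)) \<le> e * measure lborel (cbox a b)" .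
    qed
  qed
  then show ?thesis
    by (rule has_integral_spike[OF N, rotated]) (auto simp: G_def)
next
  case True
  then show ?thesis using has_integral_refl(2)[of g' b] by simp
qed

text \<open>The integral equation with its continuous integrand removes the null set: the derivative
  exists at every time, one-sided at the ends. The chain rule for a Lyapunov function then applies
  without exceptions.\<close>

lemma caratheodory_solution_classical:
  fixes f :: "'p \<Rightarrow> 'a::banach \<Rightarrow> 'a"
  assumes sol: "caratheodory_solution f s x\<^sub>0 \<xi>" and "0 \<le> a" "a \<le> b"
    and cont: "continuous_on UNIV (f i)" and s: "\<And>t. t \<in> {a..<b} \<Longrightarrow> s t = i"
    and t: "t \<in> {a..b}"
  shows "(\<xi> has_vector_derivative f i (\<xi> t)) (at t within {a..b})"
proof -
  have "abs_continuous_on_interval 0 b \<xi>"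
    using sol \<open>0 \<le> a\<close> \<open>a \<le> b\<close> by (auto simp: caratheodory_solution_def)
  then have ac: "abs_continuous_on_interval a b \<xi>"
    by (rule abs_continuous_on_interval_subset) (use \<open>0 \<le> a\<close> in auto)
  then have \<xi>: "continuous_on {a..b} \<xi>" by (rule abs_continuous_on_interval_imp_continuous_on)
  have "AE t in lebesgue. 0 \<le> t \<longrightarrow> (\<xi> has_vector_derivative f (s t) (\<xi> t)) (at t within {0..})"
    using sol by (simp add: caratheodory_solution_def)
  then obtain N where N: "N \<in> null_sets lebesgue"
    and dN: "\<And>t. t \<notin> N \<Longrightarrow> 0 \<le> t \<Longrightarrow> (\<xi> has_vector_derivative f (s t) (\<xi> t)) (at t within {0..})"
    by (auto elim!: AE_E3)
  have "negligible N" using N by (simp add: negligible_iff_null_sets)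
  \<comment> \<open>At \<open>b\<close> the signal may already be in its next mode, so
    \<open>b\<close> joins the exceptional set.\<close>
  then have Nb: "negligible (insert b N)" by simp
  have int: "\<xi> c - \<xi> a = integral {a..c} (\<lambda>r. f i (\<xi> r))" if c: "c \<in> {a..b}" for c
  proof -
    have "((\<lambda>r. f i (\<xi> r)) has_integral (\<xi> c - \<xi> a)) {a..c}"
    proof (rule fundamental_theorem_of_calculus_abs_continuous[OF _ _ Nb])
      show "abs_continuous_on_interval a c \<xi>"
        by (rule abs_continuous_on_interval_subset[OF ac]) (use c in auto)
      fix r assume r: "r \<in> {a..c} - insert b N"
      then have "(\<xi> has_vector_derivative f (s r) (\<xi> r)) (at r within {0..})"
        using \<open>0 \<le> a\<close> by (intro dN) auto
      moreover have "s r = i" using r c by (intro s) auto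
      ultimately show "(\<xi> has_vector_derivative f i (\<xi> r)) (at r within {a..c})"
        using \<open>0 \<le> a\<close> by (auto elim!: has_vector_derivative_within_subset)
    qed (use c in auto)
    then show ?thesis by (simp add: integral_unique)
  qed
  have "continuous_on {a..b} (\<lambda>r. f i (\<xi> r))"
    by (rule continuous_on_compose2[OF cont \<xi>]) simp
  from integral_has_vector_derivative[OF this t]
  have "((\<lambda>c. \<xi> a + integral {a..c} (\<lambda>r. f i (\<xi> r))) has_vector_derivative f i (\<xi> t)) (at t within {a..b})"
    by (auto intro!: derivative_eq_intros)
  then show ?thesis
    by (rule has_vector_derivative_transform[OF t, rotated]) (simp add: int[symmetric])
qed

section \<open>Lyapunov functions along solutions\<close>

lemma gradient_eq:
  assumes "GDERIV V x :> D"
  shows "gradient V x = D"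
proof -
  have "D' = D" if "GDERIV V x :> D'" for D'
  proof -
    have "(\<lambda>h. h \<bullet> D') = (\<lambda>h. h \<bullet> D)"
      using assms that unfolding gderiv_def by (rule has_derivative_unique[symmetric])
    then have "\<forall>h. h \<bullet> D' = h \<bullet> D" by meson
    then show ?thesis by (rule vector_eq_ldot[THEN iffD1])
  qed
  with assms show ?thesis unfolding gradient_def by (rule the_equality)
qed

text \<open>The integrating factor \<open>exp (c * t)\<close> turns the differential inequality into
  monotonicity of \<open>W\<close>. The sign of \<open>c\<close> is free, so growth at a negative
  rate is covered too.\<close>

lemma lyapunov_exp_decay:
  fixes V :: "'a::real_inner \<Rightarrow> real"
  assumes "continuously_differentiable V" and "a \<le> b"
    and \<xi>: "\<And>t. t \<in> {a..b} \<Longrightarrow> (\<xi> has_vector_derivative F (\<xi> t)) (at t within {a..b})"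
    and decay: "\<And>y. gradient V y \<bullet> F y \<le> - c * V y"
  shows "V (\<xi> b) \<le> exp (- c * (b - a)) * V (\<xi> a)"
proof -
  define W where "W t = exp (c * t) * V (\<xi> t)" for t
  have dW: "(W has_real_derivative exp (c * t) * (c * V (\<xi> t) + gradient V (\<xi> t) \<bullet> F (\<xi> t)))
      (at t within {a..b})" if t: "t \<in> {a..b}" for t
  proof -
    obtain D where D: "GDERIV V (\<xi> t) :> D"
      using assms(1) by (auto simp: continuously_differentiable_def)
    have "((\<lambda>t. V (\<xi> t)) has_derivative (\<lambda>h. (h *\<^sub>R F (\<xi> t)) \<bullet> gradient V (\<xi> t))) (at t within {a..b})"
      using has_derivative_compose[OF \<xi>[OF t, unfolded has_vector_derivative_def] D[unfolded gderiv_def]]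
      by (simp add: gradient_eq[OF D])
    then have "((\<lambda>t. V (\<xi> t)) has_real_derivative gradient V (\<xi> t) \<bullet> F (\<xi> t)) (at t within {a..b})"
      unfolding has_field_derivative_def by (simp add: inner_commute mult_commute_abs)
    then show ?thesis
      unfolding W_def by (auto intro!: derivative_eq_intros simp: algebra_simps)
  qed
  have "W b \<le> W a"
  proof (rule DERIV_nonpos_imp_decreasing_open[OF \<open>a \<le> b\<close>])
    fix t assume "a < t" "t < b"
    then have "at t within {a..b} = at t" by (intro at_within_Icc_at)
    then have "(W has_real_derivative exp (c * t) * (c * V (\<xi> t) + gradient V (\<xi> t) \<bullet> F (\<xi> t))) (at t)"
      using dW[of t] \<open>a < t\<close> \<open>t < b\<close> by simp
    moreover have "exp (c * t) * (c * V (\<xi> t) + gradient V (\<xi> t) \<bullet> F (\<xi> t)) \<le> 0"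
      using decay[of "\<xi> t"] by (intro mult_nonneg_nonpos) auto
    ultimately show "\<exists>y. (W has_real_derivative y) (at t) \<and> y \<le> 0" by blast
  next
    show "continuous_on {a..b} W"
      using dW DERIV_continuous unfolding continuous_on_eq_continuous_within by blast
  qed
  then have "exp (- c * b) * W b \<le> exp (- c * b) * W a" by simp
  moreover have "exp (- c * b) * W b = V (\<xi> b)"
    by (simp add: W_def exp_minus mult.assoc[symmetric])
  moreover have "exp (- c * (b - a)) = exp (- c * b) * exp (c * a)"
    by (simp add: exp_add[symmetric] algebra_simps)
  ultimately show ?thesis by (simp only: W_def mult.assoc)
qed

section \<open>Stability along a single path\<close>

text \<open>Modes and holding times are explicit arguments, so that one expression serves a fixed
  path, the random sequences and the choice of unit rates. In \<open>lam\<close> the first argument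
  selects the Lyapunov function, the second is the active mode.\<close>

definition path_weight ::
    "real \<Rightarrow> ('p \<Rightarrow> 'p \<Rightarrow> real) \<Rightarrow> (nat \<Rightarrow> 'p) \<Rightarrow> (nat \<Rightarrow> real) \<Rightarrow> nat \<Rightarrow> real" where
  "path_weight \<mu> lam X S k = (\<Prod>m\<in>{1..k}. \<mu> * exp (- lam (X m) (X (m - 1)) * S m))"

lemma path_weight_0 [simp]: "path_weight \<mu> lam X S 0 = 1"
  by (simp add: path_weight_def)

lemma path_weight_Suc [simp]:
  "path_weight \<mu> lam X S (Suc k)
    = \<mu> * exp (- lam (X (Suc k)) (X k) * S (Suc k)) * path_weight \<mu> lam X S k"
  by (simp add: path_weight_def mult.commute)

lemma path_weight_nonneg: "0 \<le> \<mu> \<Longrightarrow> 0 \<le> path_weight \<mu> lam X S k"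
  by (auto simp: path_weight_def intro!: prod_nonneg)

section \<open>Comparison functions and the interval that contains a given time\<close>

lemma class_K_nonneg: "class_K \<alpha> \<Longrightarrow> 0 \<le> r \<Longrightarrow> 0 \<le> \<alpha> r"
  unfolding class_K_def
  by (metis atLeast_iff order.order_iff_strict strict_mono_onD)

lemma class_K_less_iff: "class_K \<alpha> \<Longrightarrow> 0 \<le> r \<Longrightarrow> 0 \<le> s \<Longrightarrow> \<alpha> r < \<alpha> s \<longleftrightarrow> r < s"
  unfolding class_K_def by (auto simp: strict_mono_on_less)

lemma class_K_small:
  assumes "class_K \<alpha>" "0 < c"
  obtains \<delta> where "0 < \<delta>" "\<And>r. 0 \<le> r \<Longrightarrow> r < \<delta> \<Longrightarrow> \<alpha> r < c"
proof -
  have "continuous_on {0..} \<alpha>" "\<alpha> 0 = 0" using assms(1) by (auto simp: class_K_def)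
  then obtain \<delta> where "\<delta> > 0" "\<And>r. r \<in> {0..} \<Longrightarrow> dist r 0 < \<delta> \<Longrightarrow> dist (\<alpha> r) (\<alpha> 0) < c"
    unfolding continuous_on_iff using \<open>0 < c\<close> by (metis atLeast_iff order_refl)
  then show ?thesis using that[of \<delta>] \<open>\<alpha> 0 = 0\<close> by (auto simp: dist_real_def abs_less_iff)
qed

text \<open>Divergence guarantees that some interval reaches past \<open>t\<close>: otherwise the
  bound \<open>\<tau> k \<le> t\<close> would pass from each index to the next forever.\<close>

lemma ex_interval_of_increasing_sequence:
  fixes \<tau> :: "nat \<Rightarrow> real"
  assumes "filterlim \<tau> at_top sequentially" "\<tau> n \<le> t"
  obtains k where "n \<le> k" "\<tau> k \<le> t" "t < \<tau> (Suc k)"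
proof -
  obtain m where "\<And>k. m \<le> k \<Longrightarrow> t < \<tau> k"
    using assms(1) unfolding filterlim_at_top_dense eventually_sequentially by blast
  then have m: "t < \<tau> (n + (m - n))" by simp
  have "\<exists>d. \<tau> (n + d) \<le> t \<and> t < \<tau> (n + Suc d)"
  proof (rule ccontr)
    assume "\<not> ?thesis"
    then have "\<tau> (n + d) \<le> t" for d
      using assms(2) by (induction d) (auto simp: not_less)
    with m show False by (meson not_less)
  qed
  then show ?thesis using that le_add1 add_Suc_right by metis
qed

text \<open>Collects what holds for one fixed outcome. Probability enters only later, to show that
  almost every path satisfies these assumptions and has vanishing weights and diverging
  instants.\<close>

locale switched_path =
  fixes f :: "'p \<Rightarrow> 'a::{banach, real_inner} \<Rightarrow> 'a" and s :: "real \<Rightarrow> 'p" and \<tau> :: "nat \<Rightarrow> real"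
    and V :: "'p \<Rightarrow> 'a \<Rightarrow> real" and \<mu> :: real and lam :: "'p \<Rightarrow> 'p \<Rightarrow> real"
  assumes f_cont: "\<And>i. continuous_on UNIV (f i)"
    and \<tau>_0: "\<tau> 0 = 0" and \<tau>_mono: "strict_mono \<tau>"
    and s_const: "\<And>k t. t \<in> {\<tau> k..<\<tau> (Suc k)} \<Longrightarrow> s t = s (\<tau> k)"
    and V_C1: "\<And>i. continuously_differentiable (V i)"
    and V_nonneg: "\<And>i y. 0 \<le> V i y"
    and V_decay: "\<And>i j y. gradient (V i) y \<bullet> f j y \<le> - lam i j * V i y"
    and \<mu>_pos: "0 < \<mu>"
    and V_ratio: "\<And>i j y. V i y \<le> \<mu> * V j y"
begin

abbreviation "weight \<equiv> path_weight \<mu> lam (\<lambda>k. s (\<tau> k)) (\<lambda>k. \<tau> k - \<tau> (k - 1))"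

lemma \<tau>_nonneg: "0 \<le> \<tau> k"
  using \<tau>_0 strict_mono_mono[OF \<tau>_mono, THEN monoD, of 0 k] by simp

lemma decay_in_interval:
  assumes "caratheodory_solution f s x\<^sub>0 \<xi>" "\<tau> k \<le> t" "t \<le> \<tau> (Suc k)"
  shows "V j (\<xi> t) \<le> exp (- lam j (s (\<tau> k)) * (t - \<tau> k)) * V j (\<xi> (\<tau> k))"
proof (rule lyapunov_exp_decay[OF V_C1 \<open>\<tau> k \<le> t\<close> _ V_decay])
  fix r assume "r \<in> {\<tau> k..t}"
  then show "(\<xi> has_vector_derivative f (s (\<tau> k)) (\<xi> r)) (at r within {\<tau> k..t})"
    using assms by (intro caratheodory_solution_classical[OF assms(1) \<tau>_nonneg _ f_cont s_const]) auto
qed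

text \<open>Each induction step costs one factor: decay over the interval in the function of the
  following mode, then one comparison by \<mu> at the left end.\<close>

lemma V_at_switch:
  assumes sol: "caratheodory_solution f s x\<^sub>0 \<xi>"
  shows "V (s (\<tau> k)) (\<xi> (\<tau> k)) \<le> weight k * V (s 0) x\<^sub>0"
proof (induction k)
  case 0
  then show ?case using sol by (simp add: \<tau>_0 caratheodory_solution_def)
next
  case (Suc k)
  let ?i = "s (\<tau> k)" and ?j = "s (\<tau> (Suc k))"
  let ?e = "exp (- lam ?j ?i * (\<tau> (Suc k) - \<tau> k))"
  have "V ?j (\<xi> (\<tau> (Suc k))) \<le> ?e * V ?j (\<xi> (\<tau> k))"
    by (rule decay_in_interval[OF sol]) (use \<tau>_mono in \<open>auto simp: strict_mono_less_eq\<close>)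
  also have "\<dots> \<le> ?e * (\<mu> * V ?i (\<xi> (\<tau> k)))"
    by (intro mult_left_mono V_ratio) auto
  also have "\<dots> \<le> ?e * (\<mu> * (weight k * V (s 0) x\<^sub>0))"
    using \<mu>_pos by (intro mult_left_mono Suc.IH) auto
  finally show ?case by (simp add: mult_ac)
qed

text \<open>Between two switching instants the mode of the \<^emph>\<open>next\<close> interval is used to select the
  Lyapunov function. For a mode \<open>j\<close> with \<open>p i j = 0\<close> the exponential moment of the holding time
  may be infinite, so the growth of \<open>V j\<close> in mode \<open>i\<close> is only controllable for possible successors.\<close>

lemma V_in_interval:
  assumes sol: "caratheodory_solution f s x\<^sub>0 \<xi>" and t: "\<tau> k \<le> t" "t \<le> \<tau> (Suc k)"
  shows "V (s (\<tau> (Suc k))) (\<xi> t) \<le> (\<mu> * weight k + weight (Suc k)) * V (s 0) x\<^sub>0"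
proof -
  let ?i = "s (\<tau> k)" and ?j = "s (\<tau> (Suc k))"
  let ?l = "lam ?j ?i"
  let ?e = "exp (- ?l * (\<tau> (Suc k) - \<tau> k))"
  \<comment> \<open>The exponential is monotone in \<open>t\<close>, so it lies below the larger of
    its end values 1 and \<open>?e\<close>, hence below their sum.\<close>
  have "exp (- ?l * (t - \<tau> k)) \<le> 1 + ?e"
  proof (cases "?l \<ge> 0")
    case True
    then have "- ?l * (t - \<tau> k) \<le> 0" using t by (simp add: mult_nonneg_nonneg)
    then have "exp (- ?l * (t - \<tau> k)) \<le> 1" by simp
    then show ?thesis by (smt (verit) exp_ge_zero)
  next
    case False
    then have "- ?l * (t - \<tau> k) \<le> - ?l * (\<tau> (Suc k) - \<tau> k)"
      using t by (intro mult_left_mono) auto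
    then have "exp (- ?l * (t - \<tau> k)) \<le> ?e" by (simp only: exp_le_cancel_iff)
    then show ?thesis by linarith
  qed
  then have "exp (- ?l * (t - \<tau> k)) * V ?j (\<xi> (\<tau> k)) \<le> (1 + ?e) * V ?j (\<xi> (\<tau> k))"
    by (intro mult_right_mono V_nonneg)
  also have "\<dots> \<le> (1 + ?e) * (\<mu> * V ?i (\<xi> (\<tau> k)))"
    by (intro mult_left_mono V_ratio) (auto intro: add_nonneg_nonneg)
  also have "\<dots> \<le> (1 + ?e) * (\<mu> * (weight k * V (s 0) x\<^sub>0))"
    using \<mu>_pos by (intro mult_left_mono V_at_switch[OF sol]) (auto intro: add_nonneg_nonneg)
  finally show ?thesis
    using decay_in_interval[OF sol t, of ?j] by (simp add: algebra_simps)
qed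

section \<open>Vanishing weights imply stability and attraction\<close>

context
  fixes \<alpha>\<^sub>1 \<alpha>\<^sub>2 :: "real \<Rightarrow> real" and x :: "'a \<Rightarrow> real \<Rightarrow> 'a"
  assumes K: "class_K_inf \<alpha>\<^sub>1" "class_K_inf \<alpha>\<^sub>2"
    and V_lower: "\<And>i y. \<alpha>\<^sub>1 (norm y) \<le> V i y" and V_upper: "\<And>i y. V i y \<le> \<alpha>\<^sub>2 (norm y)"
    and sol: "\<And>x\<^sub>0. caratheodory_solution f s x\<^sub>0 (x x\<^sub>0)"
    and \<tau>_lim: "filterlim \<tau> at_top sequentially"
    and weight_lim: "weight \<longlonglongrightarrow> 0"
begin

text \<open>Serves both properties: \<open>n = 0\<close> with a small initial state gives stability,
  a late \<open>n\<close> with a small \<open>C\<close> gives attraction. The bound on the weights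
  does not involve the initial state.\<close>

lemma tail_bound:
  assumes C: "\<And>k. n \<le> k \<Longrightarrow> \<mu> * weight k + weight (Suc k) \<le> C"
    and "0 < \<epsilon>" and small: "C * \<alpha>\<^sub>2 (norm x\<^sub>0) < \<alpha>\<^sub>1 (\<epsilon> / 2)"
  shows "(SUP t\<in>{\<tau> n..}. ereal (norm (x x\<^sub>0 t))) < ereal \<epsilon>"
proof -
  have K': "class_K \<alpha>\<^sub>1" "class_K \<alpha>\<^sub>2" using K by (auto simp: class_K_inf_def)
  \<comment> \<open>A supremum of values below a bound may reach it; halving \<epsilon> keeps the
    final inequality strict.\<close>
  have "norm (x x\<^sub>0 t) < \<epsilon> / 2" if "\<tau> n \<le> t" for t
  proof -
    from ex_interval_of_increasing_sequence[OF \<tau>_lim \<open>\<tau> n \<le> t\<close>]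
    obtain k where k: "n \<le> k" "\<tau> k \<le> t" "t < \<tau> (Suc k)" by blast
    have "\<alpha>\<^sub>1 (norm (x x\<^sub>0 t)) \<le> V (s (\<tau> (Suc k))) (x x\<^sub>0 t)" by (rule V_lower)
    also have "\<dots> \<le> (\<mu> * weight k + weight (Suc k)) * V (s 0) x\<^sub>0"
      using k by (intro V_in_interval[OF sol]) auto
    also have "\<dots> \<le> C * V (s 0) x\<^sub>0"
      by (intro mult_right_mono C k V_nonneg)
    also have "\<dots> \<le> C * \<alpha>\<^sub>2 (norm x\<^sub>0)"
    proof (rule mult_left_mono[OF V_upper])
      have "0 \<le> \<mu> * weight n + weight (Suc n)"
        using \<mu>_pos by (intro add_nonneg_nonneg mult_nonneg_nonneg path_weight_nonneg) auto
      then show "0 \<le> C" using C[of n] by linarith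
    qed
    finally have "\<alpha>\<^sub>1 (norm (x x\<^sub>0 t)) < \<alpha>\<^sub>1 (\<epsilon> / 2)" using small by simp
    then show ?thesis using \<open>0 < \<epsilon>\<close> by (subst (asm) class_K_less_iff[OF K'(1)]) auto
  qed
  then have "(SUP t\<in>{\<tau> n..}. ereal (norm (x x\<^sub>0 t))) \<le> ereal (\<epsilon> / 2)"
    by (intro SUP_least) (auto intro: less_imp_le)
  also have "\<dots> < ereal \<epsilon>" using \<open>0 < \<epsilon>\<close> by simp
  finally show ?thesis .
qed

lemma bound_lim: "(\<lambda>k. \<mu> * weight k + weight (Suc k)) \<longlonglongrightarrow> 0"
  using tendsto_add[OF tendsto_mult_right_zero[OF weight_lim, of \<mu>] LIMSEQ_Suc[OF weight_lim]] by simp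

text \<open>A null sequence is bounded, by some \<open>C\<close> that depends on the path alone.
  Continuity of \<open>\<alpha>\<^sub>2\<close> at 0 then yields a \<delta> that fits
  \<open>C\<close>.\<close>

lemma path_stable:
  assumes "0 < \<epsilon>"
  shows "\<exists>\<delta>>0. \<forall>x\<^sub>0. norm x\<^sub>0 < \<delta> \<longrightarrow> (SUP t\<in>{0..}. ereal (norm (x x\<^sub>0 t))) < ereal \<epsilon>"
proof -
  have K': "class_K \<alpha>\<^sub>1" "class_K \<alpha>\<^sub>2" using K by (auto simp: class_K_inf_def)
  obtain C where "0 < C" and C: "\<And>k. \<mu> * weight k + weight (Suc k) \<le> C"
    using convergent_imp_Bseq[OF convergentI[OF bound_lim]] unfolding Bseq_def real_norm_def
    by (meson abs_le_D1)
  have "0 < \<alpha>\<^sub>1 (\<epsilon> / 2)"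
    using class_K_less_iff[OF K'(1), of 0 "\<epsilon> / 2"] K'(1) \<open>0 < \<epsilon>\<close> by (simp add: class_K_def)
  then have "0 < \<alpha>\<^sub>1 (\<epsilon> / 2) / C" using \<open>0 < C\<close> by simp
  from class_K_small[OF K'(2) this] obtain \<delta> where "0 < \<delta>"
    and \<delta>: "\<And>r. 0 \<le> r \<Longrightarrow> r < \<delta> \<Longrightarrow> \<alpha>\<^sub>2 r < \<alpha>\<^sub>1 (\<epsilon> / 2) / C" by blast
  have "(SUP t\<in>{0..}. ereal (norm (x x\<^sub>0 t))) < ereal \<epsilon>" if "norm x\<^sub>0 < \<delta>" for x\<^sub>0
  proof -
    have "C * \<alpha>\<^sub>2 (norm x\<^sub>0) < \<alpha>\<^sub>1 (\<epsilon> / 2)"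
      using \<delta>[of "norm x\<^sub>0"] that \<open>0 < C\<close> by (simp add: field_simps)
    from tail_bound[of 0, OF C \<open>0 < \<epsilon>\<close> this] show ?thesis by (simp add: \<tau>_0)
  qed
  then show ?thesis using \<open>0 < \<delta>\<close> by blast
qed

text \<open>The initial states range over a fixed ball, so smallness has to come from the weights.
  From some index \<open>n\<close> on they stay below the \<open>C\<close> fitted to
  \<open>r\<close> and \<epsilon>, and \<open>T\<close> is the instant
  \<open>\<tau> n\<close>.\<close>

lemma path_attractive:
  assumes "0 < r" "0 < \<epsilon>"
  shows "\<exists>T\<ge>0. \<forall>x\<^sub>0. norm x\<^sub>0 < r \<longrightarrow> (SUP t\<in>{T..}. ereal (norm (x x\<^sub>0 t))) < ereal \<epsilon>"
proof -
  have K': "class_K \<alpha>\<^sub>1" "class_K \<alpha>\<^sub>2" using K by (auto simp: class_K_inf_def)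
  have \<alpha>1: "0 < \<alpha>\<^sub>1 (\<epsilon> / 2)"
    using class_K_less_iff[OF K'(1), of 0 "\<epsilon> / 2"] K'(1) \<open>0 < \<epsilon>\<close> by (simp add: class_K_def)
  have \<alpha>2: "0 < \<alpha>\<^sub>2 r"
    using class_K_less_iff[OF K'(2), of 0 r] K'(2) \<open>0 < r\<close> by (simp add: class_K_def)
  define C where "C = \<alpha>\<^sub>1 (\<epsilon> / 2) / \<alpha>\<^sub>2 r"
  have "0 < C" using \<alpha>1 \<alpha>2 by (simp add: C_def)
  then obtain n where C: "\<And>k. n \<le> k \<Longrightarrow> \<mu> * weight k + weight (Suc k) \<le> C"
    using order_tendstoD(2)[OF bound_lim, of C] unfolding eventually_sequentially
    by (metis less_imp_le)
  have "(SUP t\<in>{\<tau> n..}. ereal (norm (x x\<^sub>0 t))) < ereal \<epsilon>" if "norm x\<^sub>0 < r" for x\<^sub>0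
  proof (rule tail_bound[OF C \<open>0 < \<epsilon>\<close>])
    have "\<alpha>\<^sub>2 (norm x\<^sub>0) < \<alpha>\<^sub>2 r"
      using that \<open>0 < r\<close> by (subst class_K_less_iff[OF K'(2)]) auto
    then have "C * \<alpha>\<^sub>2 (norm x\<^sub>0) < C * \<alpha>\<^sub>2 r" using \<open>0 < C\<close> by simp
    then show "C * \<alpha>\<^sub>2 (norm x\<^sub>0) < \<alpha>\<^sub>1 (\<epsilon> / 2)" using \<alpha>2 by (simp add: C_def)
  qed
  then show ?thesis using \<tau>_nonneg by blast
qed

end

end

section \<open>Weights of random paths\<close>

text \<open>Independence is the case of an indicator \<open>g\<close>. Linearity and monotone
  convergence extend it to every nonnegative \<open>g\<close> measurable for the second
  \<sigma>-algebra, infinite values included.\<close>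

lemma (in prob_space) nn_integral_indicator_mult_indep:
  assumes indep: "indep_set \<A> (sets N)" and E: "E \<in> \<A>" and N: "space N = space M"
    and g: "g \<in> borel_measurable N"
  shows "(\<integral>\<^sup>+\<omega>. indicator E \<omega> * g \<omega> \<partial>M) = emeasure M E * (\<integral>\<^sup>+\<omega>. g \<omega> \<partial>M)"
proof -
  have sub: "\<A> \<subseteq> events" "sets N \<subseteq> events"
    and ind: "\<And>F. F \<in> sets N \<Longrightarrow> prob (E \<inter> F) = prob E * prob F"
    using indep E unfolding indep_sets2_eq by auto
  have [measurable]: "E \<in> events" using E sub by blast
  have meas: "h \<in> borel_measurable M" if "h \<in> borel_measurable N" for h :: "'a \<Rightarrow> ennreal"
    using that sub(2) N unfolding measurable_def by auto
  show ?thesis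
    using g
  proof (induction rule: borel_measurable_induct)
    case (cong h g)
    then show ?case
      using nn_integral_cong[of M h g] nn_integral_cong[of M "\<lambda>\<omega>. indicator E \<omega> * h \<omega>" "\<lambda>\<omega>. indicator E \<omega> * g \<omega>"]
      by (simp add: N)
  next
    case (set F)
    then have [measurable]: "F \<in> events" using sub by blast
    have "(\<integral>\<^sup>+\<omega>. indicator E \<omega> * indicator F \<omega> \<partial>M) = emeasure M (E \<inter> F)"
      by (simp add: indicator_inter_arith[symmetric])
    then show ?case
      using ind[OF set] by (simp add: emeasure_eq_measure ennreal_mult)
  next
    case (mult u c)
    note meas[OF mult(2), measurable]
    have "(\<integral>\<^sup>+\<omega>. indicator E \<omega> * (c * u \<omega>) \<partial>M) = c * (\<integral>\<^sup>+\<omega>. indicator E \<omega> * u \<omega> \<partial>M)"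
      by (subst nn_integral_cmult[symmetric]) (auto simp: mult_ac)
    then show ?case using mult by (simp add: nn_integral_cmult mult_ac)
  next
    case (add u v)
    note meas[OF add(1), measurable] meas[OF add(3), measurable]
    show ?case using add by (simp add: distrib_left nn_integral_add)
  next
    case (seq U)
    note meas[OF seq(1), measurable]
    have inc: "incseq (\<lambda>i \<omega>. indicator E \<omega> * U i \<omega>)"
      using seq(3) by (auto simp: incseq_def le_fun_def intro!: mult_left_mono)
    have SUP: "(SUP i. U i) = (\<lambda>\<omega>. SUP i. U i \<omega>)"
      by (simp add: fun_eq_iff image_comp)
    have "(\<integral>\<^sup>+\<omega>. indicator E \<omega> * (SUP i. U i \<omega>) \<partial>M) = (\<integral>\<^sup>+\<omega>. (SUP i. indicator E \<omega> * U i \<omega>) \<partial>M)"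
      by (simp add: SUP_mult_left_ennreal)
    also have "\<dots> = (SUP i. emeasure M E * (\<integral>\<^sup>+\<omega>. U i \<omega> \<partial>M))"
      using seq inc by (subst nn_integral_monotone_convergence_SUP) auto
    also have "\<dots> = emeasure M E * (SUP i. \<integral>\<^sup>+\<omega>. U i \<omega> \<partial>M)"
      by (rule SUP_mult_left_ennreal[symmetric])
    also have "(SUP i. \<integral>\<^sup>+\<omega>. U i \<omega> \<partial>M) = (\<integral>\<^sup>+\<omega>. (SUP i. U i \<omega>) \<partial>M)"
      using seq(3) by (subst nn_integral_monotone_convergence_SUP) auto
    finally show ?case unfolding SUP .
  qed
qed

text \<open>Isolates the last mode, so that the Markov property can be used on the inner
  sum.\<close>

lemma sum_PiE_atMost_Suc:
  fixes F :: "(nat \<Rightarrow> 'p::finite) \<Rightarrow> 'b::comm_monoid_add"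
  shows "(\<Sum>s\<in>PiE {..Suc k} (\<lambda>_. UNIV). F s)
    = (\<Sum>s\<in>PiE {..k} (\<lambda>_. UNIV). \<Sum>j\<in>UNIV. F (s(Suc k := j)))"
proof -
  have "(\<Sum>s\<in>PiE {..Suc k} (\<lambda>_. UNIV). F s)
      = (\<Sum>(j, s)\<in>UNIV \<times> PiE {..k} (\<lambda>_. UNIV). F (s(Suc k := j)))"
    unfolding atMost_Suc PiE_insert_eq
    by (subst sum.reindex) (auto intro!: inj_combinator simp: case_prod_beta)
  also have "\<dots> = (\<Sum>j\<in>UNIV. \<Sum>s\<in>PiE {..k} (\<lambda>_. UNIV). F (s(Suc k := j)))"
    by (rule sum.cartesian_product[symmetric])
  also have "\<dots> = (\<Sum>s\<in>PiE {..k} (\<lambda>_. UNIV). \<Sum>j\<in>UNIV. F (s(Suc k := j)))"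
    by (rule sum.swap)
  finally show ?thesis .
qed

section \<open>A Markov chain of modes with independent holding times\<close>

locale markov_holding_times = prob_space M for M :: "'w measure" +
  fixes X :: "nat \<Rightarrow> 'w \<Rightarrow> 'p::finite" and \<iota> :: 'p and p :: "'p \<Rightarrow> 'p \<Rightarrow> real"
    and S :: "nat \<Rightarrow> 'w \<Rightarrow> real"
  assumes markov: "markov_chain M X \<iota> p"
    and indep_S: "indep_vars (\<lambda>_. borel) S {1..}"
    and distr_S: "\<And>i j. 1 \<le> i \<Longrightarrow> 1 \<le> j \<Longrightarrow> distr M borel (S i) = distr M borel (S j)"
    and indep_SX: "indep_set
       (sets (vimage_algebra (space M) (\<lambda>\<omega>. \<lambda>i\<in>{1..}. S i \<omega>) (\<Pi>\<^sub>M i\<in>{1..}. borel)))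
       (sets (vimage_algebra (space M) (\<lambda>\<omega> i. X i \<omega>) (\<Pi>\<^sub>M i\<in>UNIV. count_space UNIV)))"
begin

lemma S_measurable: "1 \<le> m \<Longrightarrow> S m \<in> borel_measurable M"
  using indep_S by (auto simp: indep_vars_def)

lemma X_measurable [measurable]: "X k \<in> measurable M (count_space UNIV)"
  using markov by (auto simp: markov_chain_def)

text \<open>A cylinder event of the chain. For fixed \<open>k\<close>, as \<open>s\<close> runs
  through the mode sequences on indices 0 to \<open>k\<close>, these events partition the
  space.\<close>

definition path_event :: "nat \<Rightarrow> (nat \<Rightarrow> 'p) \<Rightarrow> 'w set" where
  "path_event k s = {\<omega> \<in> space M. \<forall>m\<le>k. X m \<omega> = s m}"

lemma path_event_measurable [measurable]: "path_event k s \<in> events"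
  unfolding path_event_def by measurable

lemma path_event_in_vimage_algebra:
  "path_event k s \<in> sets (vimage_algebra (space M) (\<lambda>\<omega> i. X i \<omega>) (\<Pi>\<^sub>M i\<in>UNIV. count_space UNIV))"
proof -
  let ?N = "vimage_algebra (space M) (\<lambda>\<omega> i. X i \<omega>) (\<Pi>\<^sub>M i\<in>UNIV. count_space UNIV) :: 'w measure"
  have "(\<lambda>\<omega> i. X i \<omega>) \<in> measurable ?N (\<Pi>\<^sub>M i\<in>UNIV. count_space UNIV)"
    by (rule measurable_vimage_algebra1) (auto simp: space_PiM)
  then have [measurable]: "X m \<in> measurable ?N (count_space UNIV)" for m
    using measurable_compose[OF _ measurable_component_singleton[of m UNIV "\<lambda>_. count_space UNIV"]] by fastforce
  have "{\<omega> \<in> space ?N. \<forall>m\<le>k. X m \<omega> = s m} \<in> sets ?N" by measurable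
  then show ?thesis by (simp only: path_event_def space_vimage_algebra)
qed

lemma nn_integral_holding_time_eq:
  assumes "1 \<le> i" "1 \<le> j" and [measurable]: "g \<in> borel_measurable borel"
  shows "(\<integral>\<^sup>+\<omega>. g (S i \<omega>) \<partial>M) = (\<integral>\<^sup>+\<omega>. g (S j \<omega>) \<partial>M)"
proof -
  have "(\<integral>\<^sup>+\<omega>. g (S m \<omega>) \<partial>M) = (\<integral>\<^sup>+t. g t \<partial>distr M borel (S m))" if "1 \<le> m" for m
    using S_measurable[OF that] by (simp add: nn_integral_distr)
  then show ?thesis using distr_S[OF assms(1,2)] assms(1,2) by metis
qed

text \<open>The Laplace transform of the common law of the holding times, with index 1 as
  representative. For negative \<open>l\<close> it may be infinite, hence the type.\<close>

definition laplace :: "real \<Rightarrow> ennreal" where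
  "laplace l = (\<integral>\<^sup>+\<omega>. ennreal (exp (- l * S 1 \<omega>)) \<partial>M)"

text \<open>On a cylinder the modes are frozen, so the rates \<open>l m\<close> are constants.
  Independence from the chain splits off the probability of the cylinder, mutual independence
  factorises the rest, and equal laws reduce each factor to \<open>S 1\<close>.\<close>

lemma nn_integral_on_path_event:
  "(\<integral>\<^sup>+\<omega>. indicator (path_event k s) \<omega> * (\<Prod>m\<in>{1..k}. ennreal (exp (- l m * S m \<omega>))) \<partial>M)
    = emeasure M (path_event k s) * (\<Prod>m\<in>{1..k}. laplace (l m))"
proof -
  let ?N = "vimage_algebra (space M) (\<lambda>\<omega>. \<lambda>i\<in>{1..}. S i \<omega>) (\<Pi>\<^sub>M i\<in>{1..}. borel) :: 'w measure"
  have map: "(\<lambda>\<omega>. \<lambda>i\<in>{1..}. S i \<omega>) \<in> measurable ?N (\<Pi>\<^sub>M i\<in>{1..}. borel)"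
    by (rule measurable_vimage_algebra1) (auto simp: space_PiM)
  have S_N: "S m \<in> borel_measurable ?N" if "1 \<le> m" for m
    using measurable_compose[OF map measurable_component_singleton[of m "{1..}" "\<lambda>_. borel"]] that by simp
  have prod_N: "(\<lambda>\<omega>. \<Prod>m\<in>{1..k}. ennreal (exp (- l m * S m \<omega>))) \<in> borel_measurable ?N"
  proof (rule borel_measurable_prod_ennreal)
    fix m assume "m \<in> {1..k}"
    then have [measurable]: "S m \<in> borel_measurable ?N" by (intro S_N) auto
    show "(\<lambda>\<omega>. ennreal (exp (- l m * S m \<omega>))) \<in> borel_measurable ?N" by measurable
  qed
  \<comment> \<open>Independence is symmetric; the family that contains the cylinder has to come
    first.\<close>
  have "indep_set (sets (vimage_algebra (space M) (\<lambda>\<omega> i. X i \<omega>) (\<Pi>\<^sub>M i\<in>UNIV. count_space UNIV))) (sets ?N)"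
    using indep_SX unfolding indep_sets2_eq by (metis Int_commute mult.commute)
  then have "(\<integral>\<^sup>+\<omega>. indicator (path_event k s) \<omega> * (\<Prod>m\<in>{1..k}. ennreal (exp (- l m * S m \<omega>))) \<partial>M)
      = emeasure M (path_event k s) * (\<integral>\<^sup>+\<omega>. (\<Prod>m\<in>{1..k}. ennreal (exp (- l m * S m \<omega>))) \<partial>M)"
    by (rule nn_integral_indicator_mult_indep[OF _ path_event_in_vimage_algebra _ prod_N]) simp
  also have "(\<integral>\<^sup>+\<omega>. (\<Prod>m\<in>{1..k}. ennreal (exp (- l m * S m \<omega>))) \<partial>M)
      = (\<Prod>m\<in>{1..k}. \<integral>\<^sup>+\<omega>. ennreal (exp (- l m * S m \<omega>)) \<partial>M)"
  proof (rule indep_vars_nn_integral)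
    have "indep_vars (\<lambda>_. borel) S {1..k}"
      by (rule indep_vars_subset[OF indep_S]) auto
    then show "indep_vars (\<lambda>_. borel) (\<lambda>m \<omega>. ennreal (exp (- l m * S m \<omega>))) {1..k}"
      by (rule indep_vars_compose2[where Y = "\<lambda>m t. ennreal (exp (- l m * t))"]) measurable
  qed auto
  also have "\<dots> = (\<Prod>m\<in>{1..k}. laplace (l m))"
    unfolding laplace_def
  proof (rule prod.cong)
    fix m assume "m \<in> {1..k}"
    then show "(\<integral>\<^sup>+\<omega>. ennreal (exp (- l m * S m \<omega>)) \<partial>M) = (\<integral>\<^sup>+\<omega>. ennreal (exp (- l m * S 1 \<omega>)) \<partial>M)"
      by (intro nn_integral_holding_time_eq[where g = "\<lambda>t. ennreal (exp (- l m * t))"]) auto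
  qed simp
  finally show ?thesis .
qed

lemma p_nonneg: "0 \<le> p i j"
  using markov by (auto simp: markov_chain_def stochastic_matrix_def)

lemma sum_p: "(\<Sum>j\<in>UNIV. ennreal (p i j)) = 1"
  using markov p_nonneg by (subst sum_ennreal) (auto simp: markov_chain_def stochastic_matrix_def)

text \<open>The Markov property conditions only on histories of positive probability. For a null
  history both sides vanish.\<close>

lemma emeasure_path_event_Suc:
  "emeasure M (path_event (Suc k) (s(Suc k := j))) = emeasure M (path_event k s) * ennreal (p (s k) j)"
proof -
  have eq: "path_event (Suc k) (s(Suc k := j)) = {\<omega> \<in> space M. X (Suc k) \<omega> = j \<and> (\<forall>m\<le>k. X m \<omega> = s m)}"
    by (auto simp: path_event_def le_Suc_eq)
  show ?thesis
  proof (cases "prob (path_event k s) = 0")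
    case True
    have "prob (path_event (Suc k) (s(Suc k := j))) \<le> prob (path_event k s)"
      unfolding eq by (intro finite_measure_mono) (auto simp: path_event_def[of k])
    then have "prob (path_event (Suc k) (s(Suc k := j))) = 0"
      using True by (simp add: measure_le_0_iff)
    then show ?thesis using True by (simp add: emeasure_eq_measure)
  next
    case False
    then have pos: "\<P>(\<omega> in M. \<forall>m\<le>k. X m \<omega> = s m) > 0"
      by (simp add: path_event_def zero_less_measure_iff)
    then have "\<P>(\<omega> in M. X (Suc k) \<omega> = j \<bar> \<forall>m\<le>k. X m \<omega> = s m) = p (s k) j"
      using markov by (auto simp: markov_chain_def)
    then have "prob (path_event (Suc k) (s(Suc k := j))) = prob (path_event k s) * p (s k) j"
      using pos unfolding cond_prob_def eq by (simp add: path_event_def field_simps)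
    then show ?thesis
      using p_nonneg by (simp add: emeasure_eq_measure ennreal_mult)
  qed
qed

lemma path_weight_measurable [measurable]:
  "(\<lambda>\<omega>. path_weight \<mu> lam (\<lambda>m. X m \<omega>) (\<lambda>m. S m \<omega>) k) \<in> borel_measurable M"
  unfolding path_weight_def
proof (rule borel_measurable_prod)
  fix m assume "m \<in> {1..k}"
  then have [measurable]: "S m \<in> borel_measurable M" by (intro S_measurable) auto
  have [measurable]: "(\<lambda>\<omega>. lam (X m \<omega>) (X (m - 1) \<omega>)) \<in> borel_measurable M"
    using measurable_compose[OF measurable_Pair[OF X_measurable[of m] X_measurable[of "m - 1"]], of "\<lambda>(i, j). lam i j" borel]
    by (simp add: pair_measure_countable)
  show "(\<lambda>\<omega>. \<mu> * exp (- lam (X m \<omega>) (X (m - 1) \<omega>) * S m \<omega>)) \<in> borel_measurable M"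
    by measurable
qed

section \<open>Contraction of the expected weights\<close>

context
  fixes \<mu> :: real and lam :: "'p \<Rightarrow> 'p \<Rightarrow> real" and \<theta> :: real
  assumes \<mu>: "0 \<le> \<mu>" and \<theta>: "0 \<le> \<theta>" "\<theta> < 1"
    and contraction: "\<And>i. (\<Sum>j\<in>UNIV. ennreal \<mu> * ennreal (p i j) * laplace (lam j i)) \<le> ennreal \<theta>"
begin

abbreviation random_weight :: "nat \<Rightarrow> 'w \<Rightarrow> real" where
  "random_weight k \<omega> \<equiv> path_weight \<mu> lam (\<lambda>m. X m \<omega>) (\<lambda>m. S m \<omega>) k"

abbreviation paths :: "nat \<Rightarrow> (nat \<Rightarrow> 'p) set" where
  "paths k \<equiv> PiE {..k} (\<lambda>_. UNIV)"

lemma finite_paths: "finite (paths k)"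
  by (intro finite_PiE) auto

text \<open>Every outcome lies in exactly one of the cylinders, so a single summand survives, and in
  it the random modes may be replaced by constants.\<close>

lemma weight_decompose:
  assumes "\<omega> \<in> space M"
  shows "ennreal (random_weight k \<omega>) = (\<Sum>s\<in>paths k. ennreal \<mu> ^ k *
     (indicator (path_event k s) \<omega> * (\<Prod>m\<in>{1..k}. ennreal (exp (- lam (s m) (s (m - 1)) * S m \<omega>)))))"
    (is "_ = (\<Sum>s\<in>_. ?F s)")
proof -
  \<comment> \<open>Members of \<open>paths k\<close> are \<open>undefined\<close> beyond
    \<open>k\<close>, hence the restriction.\<close>
  define s where "s = restrict (\<lambda>m. X m \<omega>) {..k}"
  have s: "s \<in> paths k" by (simp add: s_def)
  have "?F s' = 0" if "s' \<in> paths k - {s}" for s'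
  proof -
    have "\<omega> \<notin> path_event k s'"
    proof
      assume *: "\<omega> \<in> path_event k s'"
      have "s' = s"
      proof (rule PiE_ext[of _ "{..k}" "\<lambda>_. UNIV"])
        show "s' i = s i" if "i \<in> {..k}" for i
          using * that by (auto simp: path_event_def s_def)
      qed (use that s in auto)
      with that show False by blast
    qed
    then show ?thesis by simp
  qed
  then have "(\<Sum>s\<in>paths k. ?F s) = (\<Sum>s'\<in>{s}. ?F s')"
    using s by (intro sum.mono_neutral_right finite_paths) auto
  also have "\<dots> = ennreal \<mu> ^ k * (\<Prod>m\<in>{1..k}. ennreal (exp (- lam (s m) (s (m - 1)) * S m \<omega>)))"
    using assms by (simp add: path_event_def s_def)
  also have "\<dots> = (\<Prod>m\<in>{1..k}. ennreal (\<mu> * exp (- lam (s m) (s (m - 1)) * S m \<omega>)))"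
    using \<mu> by (simp add: ennreal_mult prod.distrib)
  also have "\<dots> = (\<Prod>m\<in>{1..k}. ennreal (\<mu> * exp (- lam (X m \<omega>) (X (m - 1) \<omega>) * S m \<omega>)))"
    by (intro prod.cong) (auto simp: s_def)
  also have "\<dots> = ennreal (random_weight k \<omega>)"
    unfolding path_weight_def using \<mu> by (intro prod_ennreal) auto
  finally show ?thesis by simp
qed

lemma nn_integral_weight:
  "(\<integral>\<^sup>+\<omega>. ennreal (random_weight k \<omega>) \<partial>M) = (\<Sum>s\<in>paths k. ennreal \<mu> ^ k *
     (emeasure M (path_event k s) * (\<Prod>m\<in>{1..k}. laplace (lam (s m) (s (m - 1))))))"
proof -
  define G where "G s \<omega> = (\<Prod>m\<in>{1..k}. ennreal (exp (- lam (s m) (s (m - 1)) * S m \<omega>)))" for s \<omega>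
  have [measurable]: "G s \<in> borel_measurable M" for s
    unfolding G_def
  proof (rule borel_measurable_prod_ennreal)
    fix m assume "m \<in> {1..k}"
    then have [measurable]: "S m \<in> borel_measurable M" by (intro S_measurable) auto
    show "(\<lambda>\<omega>. ennreal (exp (- lam (s m) (s (m - 1)) * S m \<omega>))) \<in> borel_measurable M" by measurable
  qed
  have "(\<integral>\<^sup>+\<omega>. ennreal (random_weight k \<omega>) \<partial>M)
      = (\<integral>\<^sup>+\<omega>. (\<Sum>s\<in>paths k. ennreal \<mu> ^ k * (indicator (path_event k s) \<omega> * G s \<omega>)) \<partial>M)"
    unfolding G_def by (intro nn_integral_cong weight_decompose)
  also have "\<dots> = (\<Sum>s\<in>paths k. ennreal \<mu> ^ k * (\<integral>\<^sup>+\<omega>. indicator (path_event k s) \<omega> * G s \<omega> \<partial>M))"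
    by (simp add: nn_integral_sum nn_integral_cmult)
  finally show ?thesis
    by (simp only: G_def nn_integral_on_path_event)
qed

text \<open>Extending a mode sequence by \<open>j\<close> multiplies its term by \<mu>, by
  \<open>p (s k) j\<close> and by the Laplace value at \<open>lam j (s k)\<close>. Summed over
  \<open>j\<close>, these factors form the row sum for \<open>s k\<close>, which is at most
  \<theta>.\<close>

lemma nn_integral_weight_Suc:
  "(\<integral>\<^sup>+\<omega>. ennreal (random_weight (Suc k) \<omega>) \<partial>M) \<le> ennreal \<theta> * (\<integral>\<^sup>+\<omega>. ennreal (random_weight k \<omega>) \<partial>M)"
proof -
  define L where "L k s = (\<Prod>m\<in>{1..k}. laplace (lam (s m) (s (m - 1))))" for k :: nat and s
  have L_Suc: "L (Suc k) (s(Suc k := j)) = L k s * laplace (lam j (s k))" for s j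
  proof -
    have "L (Suc k) (s(Suc k := j)) = (\<Prod>m\<in>{1..k}. laplace (lam ((s(Suc k := j)) m) ((s(Suc k := j)) (m - 1))))
        * laplace (lam j (s k))"
      by (simp add: L_def)
    also have "(\<Prod>m\<in>{1..k}. laplace (lam ((s(Suc k := j)) m) ((s(Suc k := j)) (m - 1)))) = L k s"
      unfolding L_def by (intro prod.cong) auto
    finally show ?thesis .
  qed
  have "(\<integral>\<^sup>+\<omega>. ennreal (random_weight (Suc k) \<omega>) \<partial>M) = (\<Sum>s\<in>paths k. \<Sum>j\<in>UNIV. ennreal \<mu> ^ Suc k *
     (emeasure M (path_event k s) * ennreal (p (s k) j) * (L k s * laplace (lam j (s k)))))"
    unfolding nn_integral_weight sum_PiE_atMost_Suc emeasure_path_event_Suc L_def[symmetric] L_Suc ..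
  also have "\<dots> = (\<Sum>s\<in>paths k. (ennreal \<mu> ^ k * (emeasure M (path_event k s) * L k s)) *
      (\<Sum>j\<in>UNIV. ennreal \<mu> * ennreal (p (s k) j) * laplace (lam j (s k))))"
    unfolding sum_distrib_left by (intro sum.cong refl) (simp add: mult_ac)
  also have "\<dots> \<le> (\<Sum>s\<in>paths k. (ennreal \<mu> ^ k * (emeasure M (path_event k s) * L k s)) * ennreal \<theta>)"
    by (intro sum_mono mult_left_mono contraction) auto
  also have "\<dots> = ennreal \<theta> * (\<integral>\<^sup>+\<omega>. ennreal (random_weight k \<omega>) \<partial>M)"
    unfolding nn_integral_weight L_def by (simp add: sum_distrib_left mult_ac)
  finally show ?thesis .
qed

lemma nn_integral_weight_le: "(\<integral>\<^sup>+\<omega>. ennreal (random_weight k \<omega>) \<partial>M) \<le> ennreal \<theta> ^ k"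
proof (induction k)
  case 0
  then show ?case by (simp add: emeasure_space_1)
next
  case (Suc k)
  show ?case
    using order_trans[OF nn_integral_weight_Suc mult_left_mono[OF Suc.IH, of "ennreal \<theta>"]] by simp
qed

text \<open>By Tonelli the mean of the whole series of weights is at most a convergent geometric
  series. The series is then finite almost surely, and its terms vanish.\<close>

lemma AE_weight_tendsto_0: "AE \<omega> in M. (\<lambda>k. random_weight k \<omega>) \<longlonglongrightarrow> 0"
proof -
  have "(\<integral>\<^sup>+\<omega>. (\<Sum>k. ennreal (random_weight k \<omega>)) \<partial>M) = (\<Sum>k. \<integral>\<^sup>+\<omega>. ennreal (random_weight k \<omega>) \<partial>M)"
    by (intro nn_integral_suminf) measurable
  also have "\<dots> \<le> (\<Sum>k. ennreal (\<theta> ^ k))"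
    using nn_integral_weight_le \<theta> by (intro suminf_le) (auto simp: ennreal_power)
  also have "\<dots> = ennreal (\<Sum>k. \<theta> ^ k)"
    using \<theta> by (intro suminf_ennreal2) (auto simp: summable_geometric)
  finally have "(\<integral>\<^sup>+\<omega>. (\<Sum>k. ennreal (random_weight k \<omega>)) \<partial>M) \<noteq> \<infinity>"
    by (auto simp: top_unique)
  then have "AE \<omega> in M. (\<Sum>k. ennreal (random_weight k \<omega>)) \<noteq> \<infinity>"
    by (intro nn_integral_PInf_AE) measurable
  then show ?thesis
  proof eventually_elim
    case (elim \<omega>)
    then have "summable (\<lambda>k. random_weight k \<omega>)"
      using \<mu> by (intro summable_suminf_not_top path_weight_nonneg) auto
    then show ?case by (rule summable_LIMSEQ_zero)
  qed
qed

end

text \<open>For \<open>\<mu> = 1\<close> and all rates equal to 1 the weight is \<open>exp (- (S 1 + \<dots> + S k))\<close>, so the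
  contraction argument for the Lyapunov functions also rules out accumulation of switching instants.\<close>

lemma AE_sum_holding_times_at_top:
  assumes pos: "AE \<omega> in M. 0 < S 1 \<omega>"
  shows "AE \<omega> in M. filterlim (\<lambda>k. \<Sum>m\<in>{1..k}. S m \<omega>) at_top sequentially"
proof -
  have [measurable]: "S 1 \<in> borel_measurable M" by (rule S_measurable) simp
  \<comment> \<open>Strict, because \<open>exp (- S 1)\<close> lies below 1 almost surely, whereas
    equal means would force it to reach 1 almost surely.\<close>
  have "laplace 1 < (\<integral>\<^sup>+\<omega>. 1 \<partial>M)"
    unfolding laplace_def
  proof (rule nn_integral_less)
    have le: "AE \<omega> in M. ennreal (exp (- 1 * S 1 \<omega>)) \<le> 1"
      using pos by eventually_elim simp
    then show "AE \<omega> in M. ennreal (exp (- 1 * S 1 \<omega>)) \<le> 1" .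
    have "(\<integral>\<^sup>+\<omega>. ennreal (exp (- 1 * S 1 \<omega>)) \<partial>M) \<le> (\<integral>\<^sup>+\<omega>. 1 \<partial>M)"
      using le by (rule nn_integral_mono_AE)
    then show "(\<integral>\<^sup>+\<omega>. ennreal (exp (- 1 * S 1 \<omega>)) \<partial>M) \<noteq> \<infinity>"
      by (auto simp: emeasure_space_1 top_unique)
    show "\<not> (AE \<omega> in M. 1 \<le> ennreal (exp (- 1 * S 1 \<omega>)))"
    proof
      assume "AE \<omega> in M. 1 \<le> ennreal (exp (- 1 * S 1 \<omega>))"
      with pos have "AE \<omega> in M. False"
        by eventually_elim (simp add: ennreal_le_iff[of _ 1, simplified] flip: ennreal_1)
      then show False by simp
    qed
  qed measurable
  then have less: "laplace 1 < 1" by (simp add: emeasure_space_1)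
  then obtain q where q: "laplace 1 = ennreal q" "0 \<le> q" by (cases "laplace 1") auto
  with less have "q < 1" by (simp add: ennreal_less_one_iff)
  have "AE \<omega> in M. (\<lambda>k. path_weight 1 (\<lambda>_ _. 1) (\<lambda>m. X m \<omega>) (\<lambda>m. S m \<omega>) k) \<longlonglongrightarrow> 0"
  \<comment> \<open>The rows of \<open>p\<close> sum to 1, so every row sum in the contraction
    condition is \<open>laplace 1\<close> itself.\<close>
  proof (rule AE_weight_tendsto_0[of _ q])
    show "(\<Sum>j\<in>UNIV. ennreal 1 * ennreal (p i j) * laplace 1) \<le> ennreal q" for i
      by (simp add: q(1)[symmetric] sum_distrib_right[symmetric] sum_p)
  qed (use q \<open>q < 1\<close> in auto)
  then show ?thesis
  proof eventually_elim
    case (elim \<omega>)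
    have "(\<lambda>k. exp (- (\<Sum>m\<in>{1..k}. S m \<omega>))) \<longlonglongrightarrow> 0"
      using elim by (simp add: path_weight_def exp_sum[symmetric] sum_negf)
    \<comment> \<open>The approach to 0 is from the right, where the logarithm tends to minus
      infinity; taking logarithms recovers the sums.\<close>
    then have "filterlim (\<lambda>k. exp (- (\<Sum>m\<in>{1..k}. S m \<omega>))) (at_right 0) sequentially"
      by (intro filterlim_at_withinI) auto
    then have "filterlim (\<lambda>k. ln (exp (- (\<Sum>m\<in>{1..k}. S m \<omega>)))) at_bot sequentially"
      by (rule filterlim_compose[OF ln_at_0])
    then show ?case by (simp add: filterlim_uminus_at_top)
  qed
qed

end

section \<open>Almost sure stability\<close>

text \<open>In \<open>solution\<close> the null set is fixed before the initial state is chosen, as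
  a \<delta> or \<open>T\<close> for one outcome has to serve all initial states. Expectations are
  taken in \<open>ennreal\<close>, where 0 times infinity is 0: impossible transitions add nothing
  to the row sums in \<open>G3\<close>, even when exponential moments are infinite.\<close>

theorem theorem4p3:
  fixes M :: "'w measure"
    and f :: "'p::finite \<Rightarrow> real^'n \<Rightarrow> real^'n"
    and \<sigma> :: "real \<Rightarrow> 'w \<Rightarrow> 'p" and \<sigma>\<^sub>0 :: 'p and \<tau> :: "nat \<Rightarrow> 'w \<Rightarrow> real"
    and x :: "real^'n \<Rightarrow> 'w \<Rightarrow> real \<Rightarrow> real^'n"
    and V :: "'p \<Rightarrow> real^'n \<Rightarrow> real" and \<alpha>\<^sub>1 \<alpha>\<^sub>2 :: "real \<Rightarrow> real"
    and \<mu> :: real and lam p :: "'p \<Rightarrow> 'p \<Rightarrow> real" and k :: nat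
  assumes prob: "prob_space M" "complete_measure M"
    and f_lipschitz: "\<And>i. local_lipschitz (UNIV::real set) UNIV (\<lambda>_. f i)"
    and f_zero: "\<And>i. f i 0 = 0"
    and signal: "switching_signal M \<sigma> \<sigma>\<^sub>0 \<tau>"
    and solution: "AE \<omega> in M. \<forall>x\<^sub>0. caratheodory_solution f (\<lambda>t. \<sigma> t \<omega>) x\<^sub>0 (x x\<^sub>0 \<omega>)"
    and G1: "\<And>i. continuously_differentiable (V i)"
      "class_K_inf \<alpha>\<^sub>1" "class_K_inf \<alpha>\<^sub>2" "\<mu> > 1"
      "\<And>i y. \<alpha>\<^sub>1 (norm y) \<le> V i y" "\<And>i y. V i y \<le> \<alpha>\<^sub>2 (norm y)"
      "\<And>i j y. gradient (V i) y \<bullet> f j y \<le> - lam i j * V i y"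
      "\<And>i j y. V i y \<le> \<mu> * V j y"
    and G2: "class_GH M \<sigma> \<sigma>\<^sub>0 \<tau> p"
    and k: "k \<ge> 1"
    and G3: "\<exists>\<theta>::real. 0 \<le> \<theta> \<and> \<theta> < 1 \<and>
      (MAX i\<in>UNIV. \<Sum>j\<in>UNIV. ennreal \<mu> * ennreal (p i j) *
         (\<integral>\<^sup>+\<omega>. ennreal (exp (- lam j i * holding_time \<tau> k \<omega>)) \<partial>M)) \<le> ennreal \<theta>"
  shows "gas_almost_surely M x"
proof -
  interpret prob_space M by (rule prob(1))
  let ?S = "holding_time \<tau>" and ?X = "jump_chain \<sigma> \<tau>"
  interpret markov_holding_times M ?X \<sigma>\<^sub>0 p ?S
    unfolding markov_holding_times_def markov_holding_times_axioms_def
    using prob(1) G2[unfolded class_GH_def] by blast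
  obtain \<theta> :: real where \<theta>: "0 \<le> \<theta>" "\<theta> < 1"
    and G3': "(MAX i\<in>UNIV. \<Sum>j\<in>UNIV. ennreal \<mu> * ennreal (p i j) *
         (\<integral>\<^sup>+\<omega>. ennreal (exp (- lam j i * ?S k \<omega>)) \<partial>M)) \<le> ennreal \<theta>"
    using G3 by blast
  have laplace: "(\<integral>\<^sup>+\<omega>. ennreal (exp (- l * ?S k \<omega>)) \<partial>M) = laplace l" for l
    unfolding laplace_def using k
    by (intro nn_integral_holding_time_eq[where g = "\<lambda>t. ennreal (exp (- l * t))"]) auto
  have contraction: "(\<Sum>j\<in>UNIV. ennreal \<mu> * ennreal (p i j) * laplace (lam j i)) \<le> ennreal \<theta>" for i
    using G3' unfolding laplace by (subst (asm) Max_le_iff) auto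
  have sig: "AE \<omega> in M. \<sigma> 0 \<omega> = \<sigma>\<^sub>0 \<and> \<tau> 0 \<omega> = 0 \<and> strict_mono (\<lambda>i. \<tau> i \<omega>) \<and>
      (\<forall>i. \<forall>t\<in>{\<tau> i \<omega>..<\<tau> (Suc i) \<omega>}. \<sigma> t \<omega> = \<sigma> (\<tau> i \<omega>) \<omega>)"
    using signal unfolding switching_signal_def AE_conj_iff by blast
  have "AE \<omega> in M. 0 < ?S 1 \<omega>"
    using sig
  proof eventually_elim
    case (elim \<omega>)
    then show ?case
      using strict_monoD[of "\<lambda>i. \<tau> i \<omega>" 0 1] by (simp add: holding_time_def)
  qed
  note AE_sum = AE_sum_holding_times_at_top[OF this]
  have "AE \<omega> in M. (\<lambda>n. path_weight \<mu> lam (\<lambda>m. ?X m \<omega>) (\<lambda>m. ?S m \<omega>) n) \<longlonglongrightarrow> 0"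
    using G1(4) by (intro AE_weight_tendsto_0[OF _ \<theta> contraction]) auto
  \<comment> \<open>Four almost sure events are intersected once. The rest is deterministic on each
    path, so no null set depends on \<epsilon>, \<open>r\<close> or the initial state.\<close>
  with sig solution AE_sum have "AE \<omega> in M.
     (\<forall>\<epsilon>>0. \<exists>\<delta>>0. \<forall>x\<^sub>0. norm x\<^sub>0 < \<delta> \<longrightarrow> (SUP t\<in>{0..}. ereal (norm (x x\<^sub>0 \<omega> t))) < ereal \<epsilon>) \<and>
     (\<forall>r>0. \<forall>\<epsilon>>0. \<exists>T\<ge>0. \<forall>x\<^sub>0. norm x\<^sub>0 < r \<longrightarrow> (SUP t\<in>{T..}. ereal (norm (x x\<^sub>0 \<omega> t))) < ereal \<epsilon>)"
  proof eventually_elim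
    case (elim \<omega>)
    have "class_K \<alpha>\<^sub>1" using G1(2) by (simp add: class_K_inf_def)
    interpret switched_path f "\<lambda>t. \<sigma> t \<omega>" "\<lambda>i. \<tau> i \<omega>" V \<mu> lam
    proof
      show "continuous_on UNIV (f i)" for i
        using local_lipschitz_continuous_on[OF f_lipschitz[of i], of 0] by simp
      show "0 \<le> V i y" for i y
        using class_K_nonneg[OF \<open>class_K \<alpha>\<^sub>1\<close>, of "norm y"] G1(5)[of y i] by simp
    qed (use elim(1) G1 in auto)
    \<comment> \<open>The sum telescopes from \<open>\<tau> 0 = 0\<close>, so divergence of the sums
      of holding times is divergence of the instants.\<close>
    have "(\<Sum>m\<in>{1..n}. ?S m \<omega>) = \<tau> n \<omega>" for n
      using \<tau>_0 by (induction n) (auto simp: holding_time_def)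
    then have \<tau>_lim: "filterlim (\<lambda>n. \<tau> n \<omega>) at_top sequentially"
      using elim(3) by simp
    have weight_lim: "weight \<longlonglongrightarrow> 0"
      using elim(4) by (simp add: jump_chain_def holding_time_def)
    have sol: "\<And>x\<^sub>0. caratheodory_solution f (\<lambda>t. \<sigma> t \<omega>) x\<^sub>0 (x x\<^sub>0 \<omega>)"
      using elim(2) by blast
    show ?case
      using path_stable[OF G1(2,3,5,6) sol \<tau>_lim weight_lim]
        path_attractive[OF G1(2,3,5,6) sol \<tau>_lim weight_lim] by blast
  qed
  then show ?thesis
    unfolding gas_almost_surely_def AE_conj_iff .
qed

end
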